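(* Let $\delta\ge 5$ be an integer and let $G$ be a $2$-connected graph with $|V(G)|\ge 2(\delta-2)$ and $\delta(G)\ge\delta$. Then $G$ contains a $2$-removable $(\delta-3)$-matching. In particular, if $\delta$ is even, then $G$ contains a $2$-removable $(\delta-2)$-matching.
   Context: All graphs are finite, undirected and simple. A graph is $2$-connected if it has at least three vertices, is connected, and remains connected after deleting any one vertex. $\delta(G)$ is the minimum degree of $G$ (while $\delta$ alone denotes an integer). For $F\subseteq E(G)$, $G-F$ is the graph with vertex set $V(G)$ and edge set $E(G)\setminus F$. A matching is a set of pairwise vertex-disjoint edges; an $\ell$-matching is a matching with exactly $\ell$ edges. A matching $M$ in a $2$-connected graph $G$ is $2$-removable if $G-M$ is still $2$-connected. *)

theory Defs
  imports Main
begin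

text \<open>A finite undirected simple graph is given by its vertex set \<open>V\<close> and its edge set \<open>E\<close>,
  an edge being the two-element set of its end vertices.\<close>

definition simple_graph :: "'a set \<Rightarrow> 'a set set \<Rightarrow> bool" where
  "simple_graph V E \<longleftrightarrow> finite V \<and> (\<forall>e\<in>E. e \<subseteq> V \<and> card e = 2)"

definition degree :: "'a set set \<Rightarrow> 'a \<Rightarrow> nat" where
  "degree E v = card {e \<in> E. v \<in> e}"

text \<open>Only meaningful for finite nonempty \<open>V\<close>.\<close>

definition min_degree :: "'a set \<Rightarrow> 'a set set \<Rightarrow> nat" where
  "min_degree V E = Min (degree E ` V)"

text \<open>In a simple graph, an edge \<open>{u, v}\<close> has \<open>u \<noteq> v\<close> and both ends in \<open>V\<close>, so the reflexive
  transitive closure below relates exactly the pairs of vertices joined by a path.\<close>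

definition connected_graph :: "'a set \<Rightarrow> 'a set set \<Rightarrow> bool" where
  "connected_graph V E \<longleftrightarrow> V \<noteq> {} \<and> (\<forall>u\<in>V. \<forall>v\<in>V. (u, v) \<in> {(x, y). {x, y} \<in> E}\<^sup>*)"

definition two_connected :: "'a set \<Rightarrow> 'a set set \<Rightarrow> bool" where
  "two_connected V E \<longleftrightarrow>
     card V \<ge> 3 \<and> connected_graph V E \<and>
     (\<forall>x\<in>V. connected_graph (V - {x}) {e \<in> E. x \<notin> e})"

definition matching :: "'a set set \<Rightarrow> 'a set set \<Rightarrow> bool" where
  "matching E M \<longleftrightarrow> M \<subseteq> E \<and> pairwise disjnt M"

definition two_removable :: "'a set \<Rightarrow> 'a set set \<Rightarrow> 'a set set \<Rightarrow> bool" where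
  "two_removable V E M \<longleftrightarrow> matching E M \<and> two_connected V (E - M)"

end

theory Submission
  imports Defs
begin

text \<open>The proof distinguishes whether every matching of the graph is removable.

  If it is, nothing about connectivity is left to do: minimum degree at least \<open>\<delta> - 2\<close> together
  with \<open>2 * (\<delta> - 2)\<close> vertices forces a matching with \<open>\<delta> - 2\<close> edges, by an augmenting path
  argument (\<open>exists_matching\<close>).

  If some matching \<open>N\<close> is not removable, then the graph without \<open>N\<close> has a cut vertex \<open>c\<close> and
  the remaining vertices fall into two sides \<open>P\<close> and \<open>Q\<close> all of whose connecting edges lie in
  \<open>N\<close>. As \<open>N\<close> is a matching, every vertex of \<open>P\<close> has all its neighbours in \<open>P\<close>, except \<open>c\<close> and
  at most one vertex of \<open>Q\<close>; and symmetrically for \<open>Q\<close>. Both sides are therefore dense, and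
  \<open>(\<delta> - 2) div 2\<close> removable edges can be collected greedily in each of them: while at most
  \<open>\<delta> - 4\<close> vertices of \<open>P\<close> are covered, the uncovered vertices of \<open>P\<close> induce a graph of minimum
  degree at least \<open>2\<close> (\<open>removable_matching_in_side\<close>). That such a set of vertices, all of
  degree at least three in the whole graph, always contains an edge whose deletion keeps the
  whole graph two-connected is \<open>exists_removable_edge\<close>, a version of Mader's theorem that a
  cycle of non-removable edges contains a vertex of degree two.
  The two sides together provide \<open>2 * ((\<delta> - 2) div 2)\<close> edges, which is \<open>\<delta> - 2\<close> for even \<open>\<delta>\<close>
  and \<open>\<delta> - 3\<close> for odd \<open>\<delta>\<close>.\<close>

section \<open>Connectivity in terms of cuts\<close>

definition splits :: "'a set \<Rightarrow> 'a \<Rightarrow> 'a set \<Rightarrow> 'a set \<Rightarrow> bool" where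
  "splits V c P Q \<longleftrightarrow> c \<in> V \<and> P \<union> Q = V - {c} \<and> P \<inter> Q = {} \<and> P \<noteq> {} \<and> Q \<noteq> {}"

lemma splits_commute: "splits V c P Q \<longleftrightarrow> splits V c Q P"
  unfolding splits_def by blast

lemma splits_Diff:
  assumes "c \<in> V" "A \<subseteq> V" "c \<notin> A" "A \<noteq> {}" "y \<in> V" "y \<notin> A" "y \<noteq> c"
  shows "splits V c A (V - A - {c})"
  using assms unfolding splits_def by blast

lemma simple_graph_subset: "simple_graph V E \<Longrightarrow> F \<subseteq> E \<Longrightarrow> simple_graph V F"
  unfolding simple_graph_def by blast

lemma edge_ends:
  assumes "simple_graph V E" "{u, v} \<in> E"
  shows "u \<in> V" "v \<in> V" "u \<noteq> v"
  using assms unfolding simple_graph_def by fastforce+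

lemma edge_cases:
  assumes "simple_graph V E" "e \<in> E"
  obtains u v where "e = {u, v}" "u \<in> V" "v \<in> V" "u \<noteq> v"
  using assms unfolding simple_graph_def card_2_iff by (metis insert_subset)

lemma connected_graph_iff_cut:
  assumes "simple_graph V E"
  shows "connected_graph V E \<longleftrightarrow>
    V \<noteq> {} \<and> (\<forall>A\<subseteq>V. A \<noteq> {} \<longrightarrow> A \<noteq> V \<longrightarrow> (\<exists>a\<in>A. \<exists>b\<in>V - A. {a, b} \<in> E))"
    (is "_ \<longleftrightarrow> _ \<and> ?cut")
proof (intro iffI conjI)
  assume con: "connected_graph V E"
  then show "V \<noteq> {}" unfolding connected_graph_def by blast
  show ?cut
  proof (intro allI impI)
    fix A assume A: "A \<subseteq> V" "A \<noteq> {}" "A \<noteq> V"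
    then obtain u v where uv: "u \<in> A" "v \<in> V" "v \<notin> A" by blast
    show "\<exists>a\<in>A. \<exists>b\<in>V - A. {a, b} \<in> E"
    proof (rule ccontr)
      assume no: "\<not> ?thesis"
      have "(u, v) \<in> {(x, y). {x, y} \<in> E}\<^sup>*"
        using con uv A unfolding connected_graph_def by blast
      then have "v \<in> A"
      proof (induction rule: rtrancl_induct)
        case (step y z)
        then show ?case using no edge_ends[OF assms] by blast
      qed (use uv in simp)
      with uv show False by blast
    qed
  qed
next
  assume "V \<noteq> {} \<and> ?cut"
  then have ne: "V \<noteq> {}" and cut: ?cut by auto
  show "connected_graph V E" unfolding connected_graph_def
  proof (intro conjI ballI ne)
    fix u v assume uv: "u \<in> V" "v \<in> V"
    let ?R = "{(x, y). {x, y} \<in> E}\<^sup>*"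
    let ?A = "{w \<in> V. (u, w) \<in> ?R}"
    have "?A = V"
    proof (rule ccontr)
      assume "?A \<noteq> V"
      moreover have "u \<in> ?A" using uv by simp
      ultimately obtain a b where ab: "a \<in> ?A" "b \<in> V - ?A" "{a, b} \<in> E"
        using cut[rule_format, of ?A] by blast
      then have "(u, b) \<in> ?R" by (auto intro: rtrancl_into_rtrancl)
      with ab show False by blast
    qed
    with uv show "(u, v) \<in> ?R" by blast
  qed
qed

text \<open>Only splits around a deleted vertex need to be tested: a disconnected graph on at least
  three vertices also has such a split without connecting edges, since a side with two vertices
  can give one of them up as the deleted vertex.\<close>

lemma two_connected_iff_splits:
  assumes "simple_graph V E"
  shows "two_connected V E \<longleftrightarrow>
    card V \<ge> 3 \<and> (\<forall>c P Q. splits V c P Q \<longrightarrow> (\<exists>p\<in>P. \<exists>q\<in>Q. {p, q} \<in> E))"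
    (is "_ \<longleftrightarrow> _ \<and> ?sp")
proof -
  have sg: "simple_graph (V - {x}) {e \<in> E. x \<notin> e}" for x
    using assms unfolding simple_graph_def by blast
  show ?thesis
  proof (intro iffI conjI)
    assume tc: "two_connected V E"
    then show "card V \<ge> 3" unfolding two_connected_def by blast
    show ?sp
    proof (intro allI impI)
      fix c P Q assume s: "splits V c P Q"
      then have "connected_graph (V - {c}) {e \<in> E. c \<notin> e}"
        using tc unfolding two_connected_def splits_def by blast
      moreover have "P \<subseteq> V - {c}" "P \<noteq> {}" "P \<noteq> V - {c}" "Q = V - {c} - P"
        using s unfolding splits_def by blast+
      ultimately show "\<exists>p\<in>P. \<exists>q\<in>Q. {p, q} \<in> E"
        unfolding connected_graph_iff_cut[OF sg] by blast
    qed
  next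
    assume as: "card V \<ge> 3 \<and> ?sp"
    then have c3: "card V \<ge> 3" and sp: ?sp by blast+
    have fin: "finite V" using assms unfolding simple_graph_def by blast
    have ne: "V - {x} \<noteq> {}" for x
    proof
      assume "V - {x} = {}"
      then have "card V \<le> card {x}" by (intro card_mono) auto
      with c3 show False by simp
    qed
    have "connected_graph (V - {x}) {e \<in> E. x \<notin> e}" if "x \<in> V" for x
      unfolding connected_graph_iff_cut[OF sg]
    proof (intro conjI allI impI ne)
      fix A assume A: "A \<subseteq> V - {x}" "A \<noteq> {}" "A \<noteq> V - {x}"
      then have "splits V x A (V - {x} - A)" using that unfolding splits_def by blast
      then obtain p q where "p \<in> A" "q \<in> V - {x} - A" "{p, q} \<in> E" using sp by blast
      with A show "\<exists>a\<in>A. \<exists>b\<in>V - {x} - A. {a, b} \<in> {e \<in> E. x \<notin> e}" by blast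
    qed
    moreover have "connected_graph V E"
      unfolding connected_graph_iff_cut[OF assms]
    proof (intro conjI allI impI)
      show "V \<noteq> {}" using c3 by auto
      fix A assume A: "A \<subseteq> V" "A \<noteq> {}" "A \<noteq> V"
      have "\<exists>c\<in>V. A - {c} \<noteq> {} \<and> V - A - {c} \<noteq> {}"
      proof (rule ccontr)
        assume no: "\<not> ?thesis"
        obtain a b where ab: "a \<in> A" "b \<in> V - A" using A by blast
        have "b \<in> V - A - {a}" "a \<in> A - {b}" using ab by blast+
        then have "A - {a} = {}" "V - A - {b} = {}" using no ab A(1) by blast+
        then have "V \<subseteq> {a, b}" by blast
        then have "card V \<le> card {a, b}" by (intro card_mono) auto
        also have "\<dots> \<le> 2" by (simp add: card_insert_if)
        finally show False using c3 by simp
      qed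
      then obtain c where "c \<in> V" "A - {c} \<noteq> {}" "V - A - {c} \<noteq> {}" by blast
      then have "splits V c (A - {c}) (V - A - {c})"
        using A unfolding splits_def by blast
      then show "\<exists>a\<in>A. \<exists>b\<in>V - A. {a, b} \<in> E" using sp by blast
    qed
    ultimately show "two_connected V E" using c3 unfolding two_connected_def by blast
  qed
qed

lemma two_connected_crossing:
  assumes "simple_graph V E" "two_connected V E" "splits V c P Q"
  obtains p q where "p \<in> P" "q \<in> Q" "{p, q} \<in> E"
  using assms two_connected_iff_splits by blast

lemma not_two_connected_Diff:
  assumes "simple_graph V E" "two_connected V E" "\<not> two_connected V (E - N)"
  obtains c P Q where "splits V c P Q" "\<forall>p\<in>P. \<forall>q\<in>Q. {p, q} \<in> E \<longrightarrow> {p, q} \<in> N"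
proof -
  have "simple_graph V (E - N)" using simple_graph_subset[OF assms(1)] by blast
  from two_connected_iff_splits[OF this] assms(3) two_connected_iff_splits[OF assms(1)] assms(2)
  obtain c P Q where "splits V c P Q" "\<not> (\<exists>p\<in>P. \<exists>q\<in>Q. {p, q} \<in> E - N)" by blast
  then show thesis using that by blast
qed

section \<open>Neighbours\<close>

definition neighbours :: "'a set set \<Rightarrow> 'a \<Rightarrow> 'a set" where
  "neighbours E u = {v. {u, v} \<in> E}"

lemma neighbours_subset: "simple_graph V E \<Longrightarrow> neighbours E u \<subseteq> V"
  unfolding neighbours_def by (auto dest: edge_ends(2))

lemma finite_neighbours: "simple_graph V E \<Longrightarrow> finite (neighbours E u)"
  using finite_subset[OF neighbours_subset, of V E u] by (simp add: simple_graph_def)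

lemma card_neighbours:
  assumes "simple_graph V E"
  shows "card (neighbours E u) = degree E u"
proof -
  have "{e \<in> E. u \<in> e} = (\<lambda>v. {u, v}) ` neighbours E u"
  proof
    show "{e \<in> E. u \<in> e} \<subseteq> (\<lambda>v. {u, v}) ` neighbours E u"
    proof
      fix e assume "e \<in> {e \<in> E. u \<in> e}"
      then have e: "e \<in> E" "u \<in> e" by auto
      then obtain a b where ab: "e = {a, b}" using edge_cases[OF assms e(1)] by blast
      with e have "e = {u, if u = a then b else a}" by auto
      with e show "e \<in> (\<lambda>v. {u, v}) ` neighbours E u" unfolding neighbours_def by blast
    qed
  qed (auto simp: neighbours_def)
  moreover have "inj_on (\<lambda>v. {u, v}) (neighbours E u)"
    by (auto simp: inj_on_def doubleton_eq_iff)
  ultimately show ?thesis unfolding degree_def by (simp add: card_image)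
qed

lemma matching_edge_disjoint:
  assumes "matching E M" "e \<in> M" "f \<in> M" "v \<in> e" "v \<in> f"
  shows "e = f"
  using assms unfolding matching_def pairwise_def disjnt_def by blast

lemma matching_insert:
  assumes "matching E M" "e \<in> E" "e \<inter> \<Union>M = {}"
  shows "matching E (insert e M)"
  using assms unfolding matching_def pairwise_insert disjnt_def by blast

lemma card_Union_edges_le:
  assumes "simple_graph V E" "M \<subseteq> E" "finite M"
  shows "card (\<Union>M) \<le> 2 * card M"
proof -
  have "card (\<Union>M) \<le> sum card M" using card_Union_le_sum_card by blast
  also have "\<dots> = (\<Sum>e\<in>M. 2)"
    using assms unfolding simple_graph_def by (intro sum.cong) auto
  finally show ?thesis by simp
qed

lemma finite_edges: "simple_graph V E \<Longrightarrow> finite E"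
  by (rule finite_subset[of _ "Pow V"]) (auto simp: simple_graph_def)

section \<open>Removable edges\<close>

text \<open>The certificate that the edge \<open>{x, y}\<close> cannot be deleted: without it, the vertex \<open>c\<close>
  separates \<open>A\<close>, the side of \<open>x\<close>, from the rest, which contains \<open>y\<close>. The ends are ordered so
  that either side of the cut can play the role of \<open>A\<close>.\<close>

definition edge_side :: "'a set \<Rightarrow> 'a set set \<Rightarrow> 'a set \<Rightarrow> 'a \<Rightarrow> 'a \<Rightarrow> 'a \<Rightarrow> bool" where
  "edge_side V E A c x y \<longleftrightarrow> A \<subseteq> V \<and> c \<in> V \<and> c \<notin> A \<and> x \<in> A \<and> y \<in> V \<and> y \<notin> A \<and> y \<noteq> c \<and>
     (\<forall>a\<in>A. \<forall>b\<in>V - A - {c}. {a, b} \<in> E \<longrightarrow> a = x \<and> b = y)"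

lemma critical_edge_side:
  assumes sg: "simple_graph V E" and tc: "two_connected V E"
    and e: "{x, y} \<in> E" and crit: "\<not> two_connected V (E - {{x, y}})"
  obtains A c where "edge_side V E A c x y"
proof -
  obtain c P Q where s: "splits V c P Q"
    and cr: "\<forall>p\<in>P. \<forall>q\<in>Q. {p, q} \<in> E \<longrightarrow> {p, q} \<in> {{x, y}}"
    using not_two_connected_Diff[OF sg tc crit] .
  obtain p q where pq: "p \<in> P" "q \<in> Q" "{p, q} \<in> E"
    using two_connected_crossing[OF sg tc s] .
  then have "{p, q} = {x, y}" using cr by blast
  then consider "p = x" "q = y" | "p = y" "q = x" by (auto simp: doubleton_eq_iff)
  then show thesis
  proof cases
    case 1
    have "a = x \<and> b = y" if "a \<in> P" "b \<in> V - P - {c}" "{a, b} \<in> E" for a b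
    proof -
      have "b \<in> Q" using that s unfolding splits_def by blast
      then have "{a, b} = {x, y}" using cr[rule_format, of a b] that by simp
      moreover have "a \<noteq> y" using that(1) pq 1 s unfolding splits_def by blast
      ultimately show ?thesis by (auto simp: doubleton_eq_iff)
    qed
    then have "edge_side V E P c x y"
      unfolding edge_side_def using s pq 1 unfolding splits_def by blast
    then show thesis using that by blast
  next
    case 2
    have "a = x \<and> b = y" if "a \<in> Q" "b \<in> V - Q - {c}" "{a, b} \<in> E" for a b
    proof -
      have "b \<in> P" using that s unfolding splits_def by blast
      then have "{b, a} = {x, y}" using cr[rule_format, of b a] that by (simp add: insert_commute)
      moreover have "a \<noteq> y" using that(1) pq 2 s unfolding splits_def by blast
      ultimately show ?thesis by (auto simp: doubleton_eq_iff)
    qed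
    then have "edge_side V E Q c x y"
      unfolding edge_side_def using s pq 2 unfolding splits_def by blast
    then show thesis using that by blast
  qed
qed

text \<open>Suppose that no edge of \<open>K\<close> is removable, and take a smallest side \<open>A\<close> of a cut belonging to
  an edge \<open>{x, y}\<close> of \<open>K\<close> with \<open>x\<close> in \<open>A\<close>. A second edge \<open>{x, z}\<close> of \<open>K\<close> has a cut of its own;
  let \<open>B\<close> be its side containing \<open>z\<close> and \<open>d\<close> its cut vertex. Uncrossing the two cuts produces a
  side of \<open>{x, z}\<close> properly inside \<open>A\<close>: this is \<open>B\<close> itself if \<open>d\<close> is in \<open>A\<close>, and \<open>B \<inter> A\<close>
  otherwise. The only exception is \<open>z = c\<close>, where \<open>A\<close> turns out to be \<open>{x}\<close> and the only neighbours
  of \<open>x\<close> are \<open>y\<close> and \<open>c\<close>, against its degree. The edges of a cycle are the typical \<open>K\<close>.\<close>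

lemma exists_removable_edge:
  assumes sg: "simple_graph V E" and tc: "two_connected V E"
    and K: "K \<subseteq> E" "K \<noteq> {}"
    and two: "\<And>x y. {x, y} \<in> K \<Longrightarrow> \<exists>z. z \<noteq> y \<and> {x, z} \<in> K"
    and deg: "\<And>x. x \<in> \<Union>K \<Longrightarrow> degree E x \<ge> 3"
  shows "\<exists>e\<in>K. two_connected V (E - {e})"
proof (rule ccontr)
  assume no: "\<not> ?thesis"
  have fin: "finite V" using sg unfolding simple_graph_def by blast
  have side: "\<exists>A c. edge_side V E A c x y" if "{x, y} \<in> K" for x y
    using critical_edge_side[OF sg tc] that no K(1) by (metis subsetD)
  define good where
    "good A \<longleftrightarrow> (\<exists>c x y. {x, y} \<in> K \<and> edge_side V E A c x y)" for A
  have "\<exists>A. good A"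
  proof -
    obtain e where "e \<in> K" using K by blast
    moreover then obtain x y where "e = {x, y}" using edge_cases[OF sg] K by (metis subsetD)
    ultimately show ?thesis using side unfolding good_def by blast
  qed
  then obtain A where "good A" and least: "\<And>B. good B \<Longrightarrow> card A \<le> card B"
    using arg_min_nat_lemma[of good _ card] by (metis)
  have small: "\<not> good B" if "B \<subset> A" for B
    using \<open>good A\<close> least[of B] psubset_card_mono[OF _ that] fin finite_subset
    unfolding good_def edge_side_def by (metis not_less)
  obtain c x y where xy: "{x, y} \<in> K" and S: "edge_side V E A c x y"
    using \<open>good A\<close> unfolding good_def by blast
  have A: "A \<subseteq> V" "c \<in> V" "c \<notin> A" "x \<in> A" "y \<in> V" "y \<notin> A" "y \<noteq> c"
    and cross: "\<And>a b. a \<in> A \<Longrightarrow> b \<in> V \<Longrightarrow> b \<notin> A \<Longrightarrow> b \<noteq> c \<Longrightarrow> {a, b} \<in> E \<Longrightarrow> a = x \<and> b = y"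
    using S unfolding edge_side_def by auto
  obtain z where z: "z \<noteq> y" "{x, z} \<in> K" using two[OF xy] by blast
  have zE: "{x, z} \<in> E" "z \<in> V" "z \<noteq> x" and yE: "{x, y} \<in> E"
    using z xy K edge_ends[OF sg] by blast+
  have zA: "z \<in> A \<or> z = c" using cross[of x z] A zE z by blast
  have zK: "{z, x} \<in> K" using z by (simp add: insert_commute)
  obtain B d where T: "edge_side V E B d z x" using side[OF zK] by blast
  have B: "B \<subseteq> V" "d \<in> V" "d \<notin> B" "z \<in> B" "x \<notin> B" "x \<noteq> d"
    and crossB: "\<And>a b. a \<in> B \<Longrightarrow> b \<in> V \<Longrightarrow> b \<notin> B \<Longrightarrow> b \<noteq> d \<Longrightarrow> {a, b} \<in> E \<Longrightarrow> a = z \<and> b = x"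
    using T unfolding edge_side_def by auto
  have goodB: "good B" using T zK unfolding good_def by blast
  have sym: "{a, b} \<in> E \<longleftrightarrow> {b, a} \<in> E" for a b by (simp add: insert_commute)
  have nocut: "\<exists>a\<in>D. \<exists>b\<in>V. b \<notin> D \<and> b \<noteq> v \<and> {a, b} \<in> E"
    if "v \<in> V" "D \<subseteq> V" "v \<notin> D" "D \<noteq> {}" "w \<in> V" "w \<notin> D" "w \<noteq> v" for D v w
    using two_connected_crossing[OF sg tc splits_Diff[OF that]] by blast
  show False
  proof (cases "d \<in> A")
    case True
    (* The far side of the first cut, together with c, avoids d and is connected, so it lies
       entirely on the side of x in the second cut, where its member y lies. *)
    have yB: "y \<notin> B"
      using crossB[of y x] B z(1) yE sym A by blast
    have "c \<notin> B"
    proof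
      assume cB: "c \<in> B"
      have "\<exists>a\<in>V - A - {c} - B. \<exists>b\<in>V. b \<notin> V - A - {c} - B \<and> b \<noteq> x \<and> {a, b} \<in> E"
        by (rule nocut[of x _ c]) (use A yB cB in blast)+
      then obtain a b where ab: "a \<in> V" "a \<notin> A" "a \<noteq> c" "a \<notin> B" "b \<in> V"
        "b \<in> A \<or> b = c \<or> b \<in> B" "b \<noteq> x" "{a, b} \<in> E" by blast
      then show False using cross[of b a] crossB[of b a] cB True A sym by blast
    qed
    moreover have "B \<inter> (V - A - {c}) = {}"
    proof (rule ccontr)
      assume "B \<inter> (V - A - {c}) \<noteq> {}"
      then have "\<exists>a\<in>B \<inter> (V - A - {c}). \<exists>b\<in>V. b \<notin> B \<inter> (V - A - {c}) \<and> b \<noteq> x \<and> {a, b} \<in> E"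
        by (intro nocut[of x _ y]) (use A yB in blast)+
      then obtain a b where ab: "a \<in> B" "a \<in> V" "a \<notin> A" "a \<noteq> c" "b \<in> V"
        "b \<in> A \<or> b = c \<or> b \<notin> B" "b \<noteq> x" "{a, b} \<in> E" by blast
      then show False
        using cross[of b a] crossB[of a b] True A sym \<open>c \<notin> B\<close> by blast
    qed
    ultimately have "B \<subset> A" using B A by blast
    then show False using small goodB by blast
  next
    case dA: False
    (* Edges leaving the intersection go to c or are the edge {z, x}: within A they cross the
       second cut, and outside A they would cross the first one, which only x does. *)
    let ?D = "B \<inter> A"
    have out: "a = z \<and> b = x" if "a \<in> ?D" "b \<in> V" "b \<notin> ?D" "b \<noteq> c" "{a, b} \<in> E" for a b
    proof (cases "b \<in> A")
      case True
      then show ?thesis using crossB[of a b] that dA by blast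
    next
      case False
      then show ?thesis using cross[of a b] that B by blast
    qed
    show False
    proof (cases "z = c")
      case False
      then have "edge_side V E ?D c z x"
        unfolding edge_side_def using out A B zA by blast
      then have "good ?D" using zK unfolding good_def by blast
      moreover have "?D \<subset> A" using A B by blast
      ultimately show False using small by blast
    next
      case zc: True
      (* The edge {z, x} does not start in A now, so c would cut off B \<inter> A if it were
         nonempty, and then x would cut off the rest of A. *)
      have "?D = {}"
      proof (rule ccontr)
        assume "?D \<noteq> {}"
        then have "\<exists>a\<in>?D. \<exists>b\<in>V. b \<notin> ?D \<and> b \<noteq> c \<and> {a, b} \<in> E"
          by (intro nocut[of c _ x]) (use A B in blast)+
        then show False using out zc A by blast
      qed
      have "A - {x} = {}"
      proof (rule ccontr)
        assume "A - {x} \<noteq> {}"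
        then have "\<exists>a\<in>A - {x}. \<exists>b\<in>V. b \<notin> A - {x} \<and> b \<noteq> x \<and> {a, b} \<in> E"
          by (intro nocut[of x _ y]) (use A in blast)+
        then obtain a b where ab: "a \<in> A" "a \<noteq> x" "b \<in> V" "b \<notin> A" "{a, b} \<in> E" by blast
        then have "b = c" using cross by blast
        then show False using crossB[of c a] ab zc B \<open>?D = {}\<close> dA A sym by blast
      qed
      then have "neighbours E x \<subseteq> {y, c}"
        unfolding neighbours_def using cross[of x] A edge_ends[OF sg] by blast
      then have "card (neighbours E x) \<le> card {y, c}" by (intro card_mono) auto
      also have "\<dots> \<le> 2" by (simp add: card_insert_if)
      finally show False using deg[of x] xy card_neighbours[OF sg] by fastforce
    qed
  qed
qed

section \<open>Removable matchings inside one side of a separation\<close>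

text \<open>Deleting \<open>M\<close> does not affect degrees outside the vertices it covers, so the uncovered set
  \<open>W\<close> still satisfies the degree conditions of the removable edge lemma after the deletion.\<close>

lemma extend_removable_matching:
  assumes sg: "simple_graph V E" and M: "two_removable V E M"
    and W: "W \<noteq> {}" "W \<inter> \<Union>M = {}"
    and deg: "\<And>u. u \<in> W \<Longrightarrow> degree E u \<ge> 3"
    and two: "\<And>u. u \<in> W \<Longrightarrow> card (neighbours E u \<inter> W) \<ge> 2"
  shows "\<exists>e\<in>E. e \<subseteq> W \<and> two_removable V E (insert e M)"
proof -
  let ?K = "{e \<in> E. e \<subseteq> W}"
  have other: "\<exists>z. z \<noteq> y \<and> {x, z} \<in> ?K" if "x \<in> W" for x y
  proof -
    have "\<not> neighbours E x \<inter> W \<subseteq> {y}"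
      using two[OF that] card_mono[of "{y}" "neighbours E x \<inter> W"] by fastforce
    then show ?thesis using that unfolding neighbours_def by blast
  qed
  have "\<exists>e\<in>?K. two_connected V (E - M - {e})"
  proof (rule exists_removable_edge)
    show "simple_graph V (E - M)" using simple_graph_subset[OF sg] by blast
    show "two_connected V (E - M)" using M unfolding two_removable_def by blast
    show "?K \<subseteq> E - M"
    proof
      fix e assume e: "e \<in> ?K"
      then obtain u v where "e = {u, v}" using edge_cases[OF sg] by blast
      then show "e \<in> E - M" using e W by blast
    qed
    show "?K \<noteq> {}" using other W(1) by blast
    show "\<exists>z. z \<noteq> y \<and> {x, z} \<in> ?K" if "{x, y} \<in> ?K" for x y
      using other that by blast
    show "degree (E - M) x \<ge> 3" if "x \<in> \<Union>?K" for x
    proof -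
      have "x \<in> W" using that by blast
      then have "{e \<in> E - M. x \<in> e} = {e \<in> E. x \<in> e}" using W(2) by blast
      then show ?thesis using deg[OF \<open>x \<in> W\<close>] unfolding degree_def by simp
    qed
  qed
  then obtain e where e: "e \<in> E" "e \<subseteq> W" "two_connected V (E - M - {e})" by blast
  have "E - insert e M = E - M - {e}" by blast
  with e have "two_connected V (E - insert e M)" by simp
  moreover have "matching E (insert e M)"
    using M e W(2) unfolding two_removable_def by (intro matching_insert) auto
  ultimately show ?thesis using e unfolding two_removable_def by blast
qed

text \<open>With \<open>k\<close> edges chosen, a vertex of \<open>P\<close> has at most \<open>2 * k\<close> covered neighbours in \<open>P\<close> and at
  most two neighbours outside \<open>P\<close>. As long as \<open>2 * (k + 1) \<le> \<delta> - 2\<close>, this leaves two uncovered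
  neighbours in \<open>P\<close>, enough to extend the matching. The given matching \<open>M\<close> allows the second
  side of a separation to be treated after the first.\<close>

lemma removable_matching_in_side:
  assumes sg: "simple_graph V E" and M: "two_removable V E M" "P \<inter> \<Union>M = {}"
    and P: "P \<noteq> {}" "P \<subseteq> V"
    and deg: "\<And>u. u \<in> P \<Longrightarrow> degree E u \<ge> \<delta>" and d: "\<delta> \<ge> 3"
    and out: "\<And>u. u \<in> P \<Longrightarrow> card (neighbours E u - P - {c}) \<le> 1"
    and k: "2 * k \<le> \<delta> - 2"
  shows "\<exists>N. N \<subseteq> E \<and> \<Union>N \<subseteq> P \<and> card N = k \<and> two_removable V E (M \<union> N)"
  using k
proof (induction k)
  case 0
  then show ?case using M by (intro exI[of _ "{}"]) simp
next
  case (Suc k)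
  then obtain N where N: "N \<subseteq> E" "\<Union>N \<subseteq> P" "card N = k" "two_removable V E (M \<union> N)" by auto
  have fN: "finite N" using N(1) finite_edges[OF sg] finite_subset by blast
  have fUN: "finite (\<Union>N)"
    by (rule finite_subset[of _ V]) (use N(2) P(2) sg in \<open>auto simp: simple_graph_def\<close>)
  have cN: "card (\<Union>N) \<le> 2 * k" using card_Union_edges_le[OF sg N(1) fN] N(3) by simp
  let ?W = "P - \<Union>N"
  have two: "card (neighbours E u \<inter> ?W) \<ge> 2" if u: "u \<in> P" for u
  proof -
    let ?n = "neighbours E u"
    have fn: "finite ?n" using finite_neighbours[OF sg] .
    have "?n \<subseteq> (?n \<inter> ?W) \<union> (\<Union>N \<union> ((?n - P - {c}) \<union> {c}))" by blast
    then have "card ?n \<le> card ((?n \<inter> ?W) \<union> (\<Union>N \<union> ((?n - P - {c}) \<union> {c})))"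
      using fn fUN by (intro card_mono) auto
    also have "\<dots> \<le> card (?n \<inter> ?W) + (card (\<Union>N) + (card (?n - P - {c}) + card {c}))"
      by (meson add_left_mono card_Un_le order_trans)
    also have "\<dots> \<le> card (?n \<inter> ?W) + (2 * k + 2)"
      using cN out[OF u] by simp
    finally show ?thesis
      using deg[OF u] card_neighbours[OF sg, of u] Suc.prems by simp
  qed
  have "?W \<noteq> {}"
  proof -
    obtain u where "u \<in> P" using P by blast
    from two[OF this] have "neighbours E u \<inter> ?W \<noteq> {}"
      by (metis card.empty not_numeral_le_zero)
    then show ?thesis by blast
  qed
  moreover have "?W \<inter> \<Union>(M \<union> N) = {}" using M(2) by blast
  ultimately obtain e where e: "e \<in> E" "e \<subseteq> ?W" "two_removable V E (insert e (M \<union> N))"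
    using extend_removable_matching[OF sg N(4), of ?W] two deg d
    by (metis Diff_iff order_trans)
  have "e \<notin> N" using e edge_cases[OF sg e(1)] by blast
  then have "card (insert e N) = Suc k" using N(3) fN by simp
  then show ?case using e N by (intro exI[of _ "insert e N"]) auto
qed

text \<open>The matching \<open>N\<close> bounds the edges between the two sides: each vertex is on at
  most one of them. The edges of the removable matching are found inside the two sides.\<close>

lemma removable_matching_in_separation:
  assumes sg: "simple_graph V E" and tc: "two_connected V E"
    and s: "splits V c P Q"
    and N: "matching E N" "\<forall>p\<in>P. \<forall>q\<in>Q. {p, q} \<in> E \<longrightarrow> {p, q} \<in> N"
    and deg: "\<And>u. u \<in> V \<Longrightarrow> degree E u \<ge> \<delta>" and d: "\<delta> \<ge> 3"
    and k: "2 * k \<le> \<delta> - 2" "2 * l \<le> \<delta> - 2"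
  shows "\<exists>M. two_removable V E M \<and> card M = k + l"
proof -
  have PQ: "P \<noteq> {}" "P \<subseteq> V" "Q \<noteq> {}" "Q \<subseteq> V" "P \<inter> Q = {}" "P \<union> Q = V - {c}"
    using s unfolding splits_def by blast+
  have one: "card (neighbours E u - R - {c}) \<le> 1"
    if R: "u \<in> R" "splits V c R S" "\<forall>p\<in>R. \<forall>q\<in>S. {p, q} \<in> E \<longrightarrow> {p, q} \<in> N" for u R S
  proof -
    have "v = w" if v: "v \<in> neighbours E u - R - {c}" and w: "w \<in> neighbours E u - R - {c}" for v w
    proof -
      have "v \<in> S" "w \<in> S" "{u, v} \<in> E" "{u, w} \<in> E"
        using v w R(2) neighbours_subset[OF sg, of u]
        unfolding splits_def neighbours_def by blast+
      then have "{u, v} \<in> N" "{u, w} \<in> N" using R by blast+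
      then have "{u, v} = {u, w}" using matching_edge_disjoint[OF N(1)] by blast
      then show "v = w" by (auto simp: doubleton_eq_iff)
    qed
    then show ?thesis using finite_neighbours[OF sg, of u]
      by (simp add: card_le_Suc0_iff_eq)
  qed
  have M0: "two_removable V E {}" using tc unfolding two_removable_def matching_def by simp
  have "\<exists>A. A \<subseteq> E \<and> \<Union>A \<subseteq> P \<and> card A = k \<and> two_removable V E ({} \<union> A)"
    using one[OF _ s N(2)] deg PQ k(1) d by (intro removable_matching_in_side[OF sg M0, of P \<delta> c]) auto
  then obtain A where A: "A \<subseteq> E" "\<Union>A \<subseteq> P" "card A = k" "two_removable V E A" by auto
  have s': "splits V c Q P" using s splits_commute by metis
  have N': "\<forall>p\<in>Q. \<forall>q\<in>P. {p, q} \<in> E \<longrightarrow> {p, q} \<in> N"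
    using N(2) by (metis insert_commute)
  have "Q \<inter> \<Union>A = {}" using A PQ by blast
  then have "\<exists>B. B \<subseteq> E \<and> \<Union>B \<subseteq> Q \<and> card B = l \<and> two_removable V E (A \<union> B)"
    using one[OF _ s' N'] deg PQ k(2) d by (intro removable_matching_in_side[OF sg A(4), of Q \<delta> c]) auto
  then obtain B where B: "B \<subseteq> E" "\<Union>B \<subseteq> Q" "card B = l" "two_removable V E (A \<union> B)" by blast
  have "A \<inter> B = {}"
  proof (rule ccontr)
    assume "A \<inter> B \<noteq> {}"
    then obtain e where e: "e \<in> A" "e \<in> B" by blast
    then obtain x y where "e = {x, y}" using edge_cases[OF sg, of e] A(1) by blast
    then show False using e A B PQ by blast
  qed
  moreover have "finite A" "finite B" using A B finite_edges[OF sg] finite_subset by blast+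
  ultimately have "card (A \<union> B) = k + l" using A B by (simp add: card_Un_disjoint)
  then show ?thesis using B by blast
qed

section \<open>Large matchings\<close>

text \<open>Augmentation along the path \<open>u\<close>, \<open>x\<close>, \<open>y\<close>, \<open>w\<close>.\<close>

lemma augment_matching:
  assumes sg: "simple_graph V E" and M: "matching E M" and e: "{x, y} \<in> M"
    and u: "u \<notin> \<Union>M" "w \<notin> \<Union>M" "u \<noteq> w" and ux: "{u, x} \<in> E" "{w, y} \<in> E"
  shows "\<exists>M'. matching E M' \<and> card M' = Suc (card M)"
proof -
  have ME: "M \<subseteq> E" using M unfolding matching_def by blast
  have fM: "finite M" using ME finite_edges[OF sg] finite_subset by blast
  have xy: "x \<noteq> y" using e ME edge_ends[OF sg] by blast
  let ?L = "M - {{x, y}}"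
  have free: "x \<notin> \<Union>?L" "y \<notin> \<Union>?L" using matching_edge_disjoint[OF M e] by blast+
  have u': "u \<notin> {x, y}" "w \<notin> {x, y}" using u e by blast+
  have "matching E ?L" using M unfolding matching_def pairwise_def by blast
  then have 1: "matching E (insert {w, y} ?L)"
    using ux free u by (intro matching_insert) auto
  have 2: "matching E (insert {u, x} (insert {w, y} ?L))"
    using ux free u u' xy by (intro matching_insert[OF 1]) auto
  have "{w, y} \<notin> ?L" "{u, x} \<notin> insert {w, y} ?L"
    using u u' xy by (auto simp: doubleton_eq_iff)
  then have "card (insert {u, x} (insert {w, y} ?L)) = Suc (Suc (card ?L))"
    using fM by simp
  also have "\<dots> = Suc (card M)" using e fM by (metis card_Suc_Diff1)
  finally show ?thesis using 2 by blast
qed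

text \<open>A matching with \<open>j < k\<close> edges leaves two vertices \<open>u\<close> and \<open>w\<close> uncovered. If all their
  neighbours are covered, then at least \<open>2 * k > 2 * j\<close> adjacencies are spread over \<open>j\<close> matching
  edges, so some matching edge receives three of them and provides an augmenting path of length
  three.\<close>

lemma exists_matching:
  assumes sg: "simple_graph V E" and deg: "\<And>u. u \<in> V \<Longrightarrow> degree E u \<ge> k"
    and n: "card V \<ge> 2 * k"
  shows "\<exists>M. matching E M \<and> card M = k"
proof -
  have "\<exists>M. matching E M \<and> card M = j" if "j \<le> k" for j
    using that
  proof (induction j)
    case 0
    show ?case by (intro exI[of _ "{}"]) (simp add: matching_def)
  next
    case (Suc j)
    then obtain M where M: "matching E M" "card M = j" by auto
    have ME: "M \<subseteq> E" using M unfolding matching_def by blast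
    have fM: "finite M" using ME finite_edges[OF sg] finite_subset by blast
    have fV: "finite V" using sg unfolding simple_graph_def by blast
    have UM: "\<Union>M \<subseteq> V" using ME sg unfolding simple_graph_def by blast
    have "card (V - \<Union>M) = card V - card (\<Union>M)"
      using UM fV finite_subset by (intro card_Diff_subset) auto
    then have "2 \<le> card (V - \<Union>M)"
      using card_Union_edges_le[OF sg ME fM] n M(2) Suc.prems by linarith
    then obtain U where U: "U \<subseteq> V - \<Union>M" "card U = 2"
      by (metis obtain_subset_with_card_n)
    then obtain u w where uw: "u \<in> V" "w \<in> V" "u \<notin> \<Union>M" "w \<notin> \<Union>M" "u \<noteq> w"
      unfolding card_2_iff by blast
    show ?case
    proof (cases "\<exists>v\<in>{u, w}. \<not> neighbours E v \<subseteq> \<Union>M")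
      case True
      then obtain v z where v: "v \<in> {u, w}" "{v, z} \<in> E" "z \<notin> \<Union>M"
        unfolding neighbours_def by blast
      then have "{v, z} \<inter> \<Union>M = {}" using uw by blast
      then have "matching E (insert {v, z} M)" "{v, z} \<notin> M"
        using matching_insert[OF M(1) v(2)] by auto
      then show ?thesis using M(2) fM by (intro exI[of _ "insert {v, z} M"]) simp
    next
      case False
      have cov: "card (neighbours E v) = (\<Sum>e\<in>M. card (neighbours E v \<inter> e))" if "v \<in> {u, w}" for v
      proof -
        have "neighbours E v = (\<Union>e\<in>M. neighbours E v \<inter> e)" using False that by blast
        moreover have "card (\<Union>e\<in>M. neighbours E v \<inter> e) = (\<Sum>e\<in>M. card (neighbours E v \<inter> e))"
          using fM finite_neighbours[OF sg, of v] matching_edge_disjoint[OF M(1)]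
          by (intro card_UN_disjoint) blast+
        ultimately show ?thesis by simp
      qed
      have "\<exists>e\<in>M. card (neighbours E u \<inter> e) + card (neighbours E w \<inter> e) > 2"
      proof (rule ccontr)
        assume "\<not> ?thesis"
        then have "(\<Sum>e\<in>M. card (neighbours E u \<inter> e) + card (neighbours E w \<inter> e)) \<le> (\<Sum>e\<in>M. 2)"
          by (intro sum_mono) auto
        then have "card (neighbours E u) + card (neighbours E w) \<le> 2 * j"
          using cov[of u] cov[of w] M(2) by (simp add: sum.distrib)
        then show False
          using deg[OF uw(1)] deg[OF uw(2)] Suc.prems card_neighbours[OF sg] by fastforce
      qed
      then obtain e where e: "e \<in> M" "card (neighbours E u \<inter> e) + card (neighbours E w \<inter> e) > 2"
        by blast
      obtain x y where xy: "e = {x, y}" "x \<noteq> y" using edge_cases[OF sg, of e] e(1) ME by blast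
      have "\<exists>x y. e = {x, y} \<and> {u, x} \<in> E \<and> {w, y} \<in> E"
      proof (rule ccontr)
        assume no: "\<not> ?thesis"
        have c: "card (neighbours E v \<inter> e) = of_bool ({v, x} \<in> E) + of_bool ({v, y} \<in> E)" for v
          using xy unfolding neighbours_def by (auto simp: Int_insert_right)
        have "e = {y, x}" using xy by blast
        then have "\<not> ({u, x} \<in> E \<and> {w, y} \<in> E)" "\<not> ({u, y} \<in> E \<and> {w, x} \<in> E)" using no xy by blast+
        then show False using e(2) unfolding c by (auto simp: of_bool_def split: if_splits)
      qed
      then obtain x y where "{x, y} \<in> M" "{u, x} \<in> E" "{w, y} \<in> E" using e by blast
      then show ?thesis using augment_matching[OF sg M(1)] uw M(2) by metis
    qed
  qed
  then show ?thesis by blast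
qed

section \<open>Removable matchings\<close>

text \<open>The size is given as a sum \<open>k + l\<close> because \<open>k\<close> edges are taken from one side of a separation
  and \<open>l\<close> from the other.\<close>

lemma exists_removable_matching:
  assumes sg: "simple_graph V E" and tc: "two_connected V E"
    and deg: "\<And>u. u \<in> V \<Longrightarrow> degree E u \<ge> \<delta>" and d: "\<delta> \<ge> 3"
    and n: "card V \<ge> 2 * (k + l)"
    and k: "2 * k \<le> \<delta> - 2" "2 * l \<le> \<delta> - 2"
  shows "\<exists>M. two_removable V E M \<and> card M = k + l"
proof (cases "\<forall>N. matching E N \<longrightarrow> two_connected V (E - N)")
  case True
  have "degree E u \<ge> k + l" if "u \<in> V" for u using deg[OF that] k by linarith
  then obtain M where "matching E M" "card M = k + l" using exists_matching[OF sg] n by blast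
  then show ?thesis using True unfolding two_removable_def by blast
next
  case False
  then obtain N where N: "matching E N" "\<not> two_connected V (E - N)" by blast
  obtain c P Q where s: "splits V c P Q"
    and cr: "\<forall>p\<in>P. \<forall>q\<in>Q. {p, q} \<in> E \<longrightarrow> {p, q} \<in> N"
    using not_two_connected_Diff[OF sg tc N(2)] .
  show ?thesis using removable_matching_in_separation[OF sg tc s N(1) cr deg d k] .
qed

theorem theorem5p3:
  fixes V :: "'a set" and E :: "'a set set" and \<delta> :: nat
  assumes "\<delta> \<ge> 5"
    and "simple_graph V E"
    and "two_connected V E"
    and "card V \<ge> 2 * (\<delta> - 2)"
    and "min_degree V E \<ge> \<delta>"
  shows "(\<exists>M. two_removable V E M \<and> card M = \<delta> - 3) \<and>
         (even \<delta> \<longrightarrow> (\<exists>M. two_removable V E M \<and> card M = \<delta> - 2))"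
proof -
  have fin: "finite V" using assms(2) unfolding simple_graph_def by blast
  have deg: "degree E u \<ge> \<delta>" if "u \<in> V" for u
  proof -
    have "min_degree V E \<le> degree E u"
      unfolding min_degree_def using fin that by (intro Min_le) auto
    then show ?thesis using assms(5) by simp
  qed
  have main: "\<exists>M. two_removable V E M \<and> card M = k + l"
    if "2 * k \<le> \<delta> - 2" "2 * l \<le> \<delta> - 2" for k l
    using exists_removable_matching[OF assms(2,3) deg _ _ that] assms(1,4) that by fastforce
  show ?thesis
  proof (intro conjI impI)
    have "2 * ((\<delta> - 2) div 2) \<le> \<delta> - 2" "2 * (\<delta> - 3 - (\<delta> - 2) div 2) \<le> \<delta> - 2"
      "(\<delta> - 2) div 2 + (\<delta> - 3 - (\<delta> - 2) div 2) = \<delta> - 3"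
      using assms(1) by linarith+
    then show "\<exists>M. two_removable V E M \<and> card M = \<delta> - 3" using main by metis
  next
    assume "even \<delta>"
    then have "(\<delta> - 2) div 2 + (\<delta> - 2) div 2 = \<delta> - 2" by presburger
    then show "\<exists>M. two_removable V E M \<and> card M = \<delta> - 2"
      using main[of "(\<delta> - 2) div 2" "(\<delta> - 2) div 2"] by simp
  qed
qed

end
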